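(* Let $X$ and $Y$ be two simple graphs, each on $n$ vertices, such that $X$ and $Y$ are both connected and $$\min(\delta(X),\delta(Y))+2\max(\delta(X),\delta(Y))\ge 2n.$$ Then the friends-and-strangers graph $\mathsf{FS}(X,Y)$ is connected.
   Context: For a simple graph $G$, $\delta(G)$ denotes its minimum degree. For two simple graphs $X$ and $Y$ with the same finite number of vertices, the friends-and-strangers graph $\mathsf{FS}(X,Y)$ has as vertex set all bijections $\sigma:V(X)\to V(Y)$; two bijections $\sigma,\tau$ are adjacent if and only if there are distinct vertices $a,b\in V(X)$ with $\{a,b\}\in E(X)$, $\{\sigma(a),\sigma(b)\}\in E(Y)$, $\tau(a)=\sigma(b)$, $\tau(b)=\sigma(a)$, and $\tau(w)=\sigma(w)$ for all $w\in V(X)\setminus\{a,b\}$. *)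

theory Defs
  imports "Graph_Theory.Graph_Theory" "HOL-Library.FuncSet"
begin

text \<open>
  A finite simple graph is a \<^locale>\<open>pair_graph\<close>: finite, loop-free and symmetric, so that the
  undirected edge \<open>{a, b}\<close> is the pair of opposite arcs \<open>(a, b)\<close> and \<open>(b, a)\<close>.  In such a graph
  the degree of a vertex is its \<^const>\<open>out_degree\<close>.  The library's \<^const>\<open>connected\<close> requires at
  least one vertex.
\<close>

text \<open>Meaningful only for finite graphs with at least one vertex (\<^const>\<open>Min\<close> of the empty set
  is unspecified).\<close>
definition min_degree :: "('a, 'e) pre_digraph \<Rightarrow> nat" where
  "min_degree G = Min (out_degree G ` verts G)"

text \<open>A bijection between vertex sets is a total HOL function; \<^const>\<open>extensional\<close> fixes its
  values outside \<open>V(X)\<close>, so that each bijection is represented exactly once.\<close>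
definition vertex_bijections :: "'a pair_pre_digraph \<Rightarrow> 'b pair_pre_digraph \<Rightarrow> ('a \<Rightarrow> 'b) set" where
  "vertex_bijections X Y =
     {\<sigma> \<in> extensional (pverts X). bij_betw \<sigma> (pverts X) (pverts Y)}"

definition FS :: "'a pair_pre_digraph \<Rightarrow> 'b pair_pre_digraph \<Rightarrow> ('a \<Rightarrow> 'b) pair_pre_digraph" where
  "FS X Y = \<lparr> pverts = vertex_bijections X Y,
     parcs = {(\<sigma>, \<tau>). \<sigma> \<in> vertex_bijections X Y \<and> \<tau> \<in> vertex_bijections X Y \<and>
       (\<exists>a\<in>pverts X. \<exists>b\<in>pverts X. a \<noteq> b \<and> (a, b) \<in> parcs X \<and> (\<sigma> a, \<sigma> b) \<in> parcs Y \<and>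
         \<tau> a = \<sigma> b \<and> \<tau> b = \<sigma> a \<and> (\<forall>w \<in> pverts X - {a, b}. \<tau> w = \<sigma> w))} \<rparr>"

lemma pair_graph_FS:
  assumes X: "pair_graph X" and Y: "pair_graph Y"
  shows "pair_graph (FS X Y)"
proof -
  interpret X: pair_graph X by (fact X)
  interpret Y: pair_graph Y by (fact Y)
  have "vertex_bijections X Y \<subseteq> pverts X \<rightarrow>\<^sub>E pverts Y"
    by (auto simp: vertex_bijections_def PiE_def bij_betw_def)
  then have fin: "finite (vertex_bijections X Y)"
    by (rule finite_subset) (simp add: finite_PiE)
  have fina: "finite (parcs (FS X Y))"
    by (rule finite_subset[of _ "vertex_bijections X Y \<times> vertex_bijections X Y"])
       (auto simp: FS_def fin)
  have inj: "\<sigma> a \<noteq> \<sigma> b"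
    if "\<sigma> \<in> vertex_bijections X Y" "a \<in> pverts X" "b \<in> pverts X" "a \<noteq> b" for \<sigma> a b
    using that by (auto simp: vertex_bijections_def bij_betw_def inj_on_def)
  have noloop: "fst e \<noteq> snd e" if "e \<in> parcs (FS X Y)" for e
  proof
    assume "fst e = snd e"
    then obtain \<sigma> where e: "e = (\<sigma>, \<sigma>)" by (metis prod.collapse)
    with that obtain a b where "\<sigma> \<in> vertex_bijections X Y" "a \<in> pverts X" "b \<in> pverts X" "a \<noteq> b"
      "\<sigma> a = \<sigma> b" by (auto simp: FS_def)
    with inj show False by metis
  qed
  have symm: "(\<tau>, \<sigma>) \<in> parcs (FS X Y)" if "(\<sigma>, \<tau>) \<in> parcs (FS X Y)" for \<sigma> \<tau>
  proof -
    from that obtain a b where *: "\<sigma> \<in> vertex_bijections X Y" "\<tau> \<in> vertex_bijections X Y"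
      "a \<in> pverts X" "b \<in> pverts X" "a \<noteq> b" "(a, b) \<in> parcs X" "(\<sigma> a, \<sigma> b) \<in> parcs Y"
      "\<tau> a = \<sigma> b" "\<tau> b = \<sigma> a" "\<forall>w \<in> pverts X - {a, b}. \<tau> w = \<sigma> w"
      by (auto simp: FS_def)
    have "(\<tau> a, \<tau> b) \<in> parcs Y"
      using *(7,8,9) Y.graph_symmetric by (metis Y.arcs_symmetric)
    with * show ?thesis unfolding FS_def
      by simp metis
  qed
  have sym: "sym (parcs (FS X Y))"
    using symm by (auto intro: symI)
  have wf: "fst e \<in> pverts (FS X Y) \<and> snd e \<in> pverts (FS X Y)" if "e \<in> parcs (FS X Y)" for e
    using that by (auto simp: FS_def)
  have "finite (pverts (FS X Y))"
    using fin by (simp add: FS_def)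
  then show ?thesis
    by unfold_locales (use wf noloop fina sym in \<open>simp_all add: symmetric_def\<close>)
qed

end

theory Submission
  imports Defs "HOL-Combinatorics.Permutations"
begin

text \<open>
  Let \<open>Y\<close> be the denser graph (inverting bijections exchanges the roles of \<open>X\<close> and \<open>Y\<close>).  If every
  person (vertex of \<open>Y\<close>) has at most \<open>s\<close> strangers (non-neighbours), the degree condition says that
  every position (vertex of \<open>X\<close>) has at least \<open>2s + 2\<close> neighbours.  As \<open>X\<close> is connected, it suffices
  that two strangers \<open>u\<close>, \<open>v\<close> standing on an edge \<open>ab\<close> of \<open>X\<close> can be exchanged.  Call a position good
  if it holds a common friend of \<open>u\<close> and \<open>v\<close>; at most \<open>2s - 2\<close> positions other than \<open>a\<close>, \<open>b\<close> are
  not good.  The exchange is possible within a few positions in each of these situations: \<open>a\<close> and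
  \<open>b\<close> have a good common neighbour; one of them has two good neighbours holding friends; or there
  are a common neighbour \<open>c\<close> and good neighbours \<open>d\<close> of \<open>a\<close> and \<open>e\<close> of \<open>b\<close>, both holding a friend of
  the person at \<open>c\<close>.  Otherwise the persons at the good neighbours \<open>A\<close> of \<open>a\<close> are mutual strangers,
  and so are those at the good neighbours \<open>B\<close> of \<open>b\<close>, and every common neighbour of \<open>a\<close> and \<open>b\<close> holds
  a stranger of all of \<open>A\<close> or of all of \<open>B\<close>.  With \<open>t\<close> common neighbours this gives
  \<open>|A| + |B| - 2 + t \<le> 2s\<close>, against \<open>|A| + |B| \<ge> 2(2s + 1) - (2s - 2) - t\<close>.
\<close>

section \<open>Finding an exchange configuration\<close>

text \<open>The counting on bare sets of positions: \<open>Na\<close> and \<open>Nb\<close> stand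
  for the neighbourhoods of \<open>a\<close> and \<open>b\<close>, and \<open>S x\<close> for the
  positions of the strangers of the person at \<open>x\<close>.\<close>

lemma exchange_configuration:
  fixes Na Nb :: "'a set" and S :: "'a \<Rightarrow> 'a set" and s :: nat
  assumes fin: "finite Na" "finite Nb"
    and degs: "2 * s + 1 \<le> card (Na - {b})" "2 * s + 1 \<le> card (Nb - {a})"
    and notin: "a \<notin> Na" "b \<notin> Nb"
    and S: "\<And>x. x \<in> Na \<union> Nb \<union> {a, b} \<Longrightarrow> finite (S x) \<and> card (S x) \<le> s"
    and ab: "a \<noteq> b" "b \<in> S a" "a \<in> S b"
  obtains (triangle) c where "c \<in> Na \<inter> Nb" "c \<notin> S a \<union> S b"
    | (star_a) c d where "c \<in> Na - {b}" "d \<in> Na - {b}" "c \<noteq> d" "c \<notin> S a \<union> S b" "d \<notin> S a \<union> S b"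
        "d \<notin> S c"
    | (star_b) c d where "c \<in> Nb - {a}" "d \<in> Nb - {a}" "c \<noteq> d" "c \<notin> S a \<union> S b" "d \<notin> S a \<union> S b"
        "d \<notin> S c"
    | (bull) c d e where "c \<in> Na \<inter> Nb" "d \<in> Na - {b}" "e \<in> Nb - {a}" "d \<notin> S a \<union> S b"
        "e \<notin> S a \<union> S b" "c \<notin> S d" "c \<notin> S e"
proof (rule ccontr)
  assume "\<not> thesis"
  note no = triangle star_a star_b bull
  \<comment> \<open>\<open>K\<close> collects the positions other than \<open>a\<close> and
    \<open>b\<close> that are not good. Both \<open>a\<close> and \<open>b\<close> lie in
    \<open>S a \<union> S b\<close>, which is why \<open>K\<close> has at most 2s - 2
    elements.\<close>
  define K where "K = S a \<union> S b - {a, b}"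
  define A where "A = Na - {b} - (S a \<union> S b)"
  define B where "B = Nb - {a} - (S a \<union> S b)"
  define T where "T = Na \<inter> Nb"
  define TA where "TA = {c \<in> T. \<forall>d\<in>A. c \<in> S d}"
  define TB where "TB = {c \<in> T. \<forall>e\<in>B. c \<in> S e}"
  have finS: "finite (S a)" "finite (S b)" "card (S a) \<le> s" "card (S b) \<le> s"
    using S by auto
  have finK: "finite K" and finT: "finite T" and finA: "finite A" and finB: "finite B"
    using fin finS by (auto simp: K_def T_def A_def B_def)
  have "card (S a \<union> S b) \<le> 2 * s"
    using card_Un_le[of "S a" "S b"] finS by linarith
  moreover have "card (S a \<union> S b) = card K + 2"
  proof -
    have "S a \<union> S b = K \<union> {a, b}" "K \<inter> {a, b} = {}" using ab by (auto simp: K_def)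
    then show ?thesis using finK ab(1) by (simp add: card_Un_disjoint)
  qed
  ultimately have K: "card K + 2 \<le> 2 * s" by simp
  \<comment> \<open>There is no \<open>triangle\<close>, so no common neighbour is good.\<close>
  have TK: "T \<subseteq> K"
  proof
    fix c assume "c \<in> T"
    then show "c \<in> K" using no(1)[of c] \<open>\<not> thesis\<close> notin by (auto simp: T_def K_def)
  qed
  have A: "card A + card (Na \<inter> K) \<ge> 2 * s + 1"
  proof -
    have "Na - {b} = A \<union> (Na \<inter> K)" "A \<inter> (Na \<inter> K) = {}"
      using notin ab by (auto simp: A_def K_def)
    then show ?thesis using degs(1) finA fin by (simp add: card_Un_disjoint)
  qed
  have B: "card B + card (Nb \<inter> K) \<ge> 2 * s + 1"
  proof -
    have "Nb - {a} = B \<union> (Nb \<inter> K)" "B \<inter> (Nb \<inter> K) = {}"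
      using notin ab by (auto simp: B_def K_def)
    then show ?thesis using degs(2) finB fin by (simp add: card_Un_disjoint)
  qed
  \<comment> \<open>Inclusion-exclusion inside \<open>K\<close>, where exactly the common neighbours
    are counted twice.\<close>
  have "card (Na \<inter> K) + card (Nb \<inter> K) = card ((Na \<union> Nb) \<inter> K) + card T"
  proof -
    have "(Na \<inter> K) \<union> (Nb \<inter> K) = (Na \<union> Nb) \<inter> K" "(Na \<inter> K) \<inter> (Nb \<inter> K) = T"
      using TK by (auto simp: T_def)
    then show ?thesis using card_Un_Int[of "Na \<inter> K" "Nb \<inter> K"] finK by simp
  qed
  moreover have "card ((Na \<union> Nb) \<inter> K) \<le> card K" "card (Na \<inter> K) \<le> card K" "card (Nb \<inter> K) \<le> card K"
    using finK by (auto intro: card_mono)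
  ultimately have AB: "card A + card B + card T \<ge> 2 * s + 4" and "card A > 0" and "card B > 0"
    using A B K by linarith+
  \<comment> \<open>Seen from \<open>x\<close>, both \<open>Z - {x}\<close> and \<open>U\<close>
    consist of strangers, and they are disjoint because \<open>U\<close> is inside \<open>K\<close>
    and \<open>Z\<close> outside.\<close>
  have bound: "card Z + card U \<le> s + 1"
    if "x \<in> Z" "finite Z" "U \<subseteq> K" "Z \<inter> K = {}" "U \<subseteq> S x" "\<forall>y\<in>Z. y \<noteq> x \<longrightarrow> y \<in> S x"
      "finite (S x)" "card (S x) \<le> s" for x and Z U :: "'a set"
  proof -
    have "card ((Z - {x}) \<union> U) \<le> card (S x)"
      using that by (intro card_mono) auto
    moreover have "card ((Z - {x}) \<union> U) = card (Z - {x}) + card U"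
      using that finite_subset[OF that(3) finK] by (intro card_Un_disjoint) auto
    ultimately show ?thesis using that by simp
  qed
  obtain x where x: "x \<in> A" using \<open>card A > 0\<close> by fastforce
  have "card A + card TA \<le> s + 1"
  proof (rule bound[OF x finA])
    show "\<forall>y\<in>A. y \<noteq> x \<longrightarrow> y \<in> S x"
      using no(2)[of x] x \<open>\<not> thesis\<close> by (auto simp: A_def)
  qed (use x TK S[of x] in \<open>auto simp: TA_def A_def K_def\<close>)
  moreover obtain y where y: "y \<in> B" using \<open>card B > 0\<close> by fastforce
  have "card B + card TB \<le> s + 1"
  proof (rule bound[OF y finB])
    show "\<forall>z\<in>B. z \<noteq> y \<longrightarrow> z \<in> S y"
      using no(3)[of y] y \<open>\<not> thesis\<close> by (auto simp: B_def)
  qed (use y TK S[of y] in \<open>auto simp: TB_def B_def K_def\<close>)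
  \<comment> \<open>A common neighbour outside \<open>TA\<close> and \<open>TB\<close> would give a
    \<open>bull\<close>. Adding the two bounds then leaves at most 2s + 2 for the sum that
    \<open>AB\<close> puts at 2s + 4 or more.\<close>
  moreover have "T \<subseteq> TA \<union> TB"
  proof (rule ccontr)
    assume "\<not> T \<subseteq> TA \<union> TB"
    then obtain c d e where "c \<in> T" "d \<in> A" "c \<notin> S d" "e \<in> B" "c \<notin> S e"
      by (auto simp: TA_def TB_def)
    then show False using no(4)[of c d e] \<open>\<not> thesis\<close> by (auto simp: A_def B_def T_def)
  qed
  then have "card T \<le> card TA + card TB"
    using finT card_mono[of "TA \<union> TB" T] card_Un_le[of TA TB]
    by (simp add: TA_def TB_def)
  ultimately show False using AB by linarith
qed

section \<open>Moving in the friends-and-strangers graph\<close>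

text \<open>The library defines connectedness through the symmetric closure; here the arcs are
  already symmetric, so directed reachability suffices.\<close>

lemma (in pair_graph) connected_iff_reachable:
  "connected (with_proj G) \<longleftrightarrow>
    pverts G \<noteq> {} \<and> (\<forall>u\<in>pverts G. \<forall>v\<in>pverts G. u \<rightarrow>\<^sup>*\<^bsub>with_proj G\<^esub> v)"
proof
  assume "connected (with_proj G)"
  then have "strongly_connected (with_proj G)"
    by (rule symmetric_connected_imp_strongly_connected[OF sym_arcs])
  then show "pverts G \<noteq> {} \<and> (\<forall>u\<in>pverts G. \<forall>v\<in>pverts G. u \<rightarrow>\<^sup>*\<^bsub>with_proj G\<^esub> v)"
    by (simp add: strongly_connected_def)
next
  assume "pverts G \<noteq> {} \<and> (\<forall>u\<in>pverts G. \<forall>v\<in>pverts G. u \<rightarrow>\<^sup>*\<^bsub>with_proj G\<^esub> v)"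
  then show "connected (with_proj G)"
    by (auto simp: connected_def strongly_connected_def intro: reachable_mk_symmetricI)
qed

lemma (in pair_graph) min_degree_le_card_neighbours:
  assumes "v \<in> pverts G"
  shows "min_degree (with_proj G) \<le> card {w. (v, w) \<in> parcs G}"
proof -
  have "out_arcs (with_proj G) v = Pair v ` {w. (v, w) \<in> parcs G}"
    by (auto simp: out_arcs_def)
  then have "out_degree (with_proj G) v = card {w. (v, w) \<in> parcs G}"
    by (simp add: out_degree_def card_image inj_on_def)
  then show ?thesis
    using assms pair_finite_verts unfolding min_degree_def
    by (metis Min_le finite_imageI imageI with_proj_simps(1))
qed

locale friends_and_strangers = X: pair_graph X + Y: pair_graph Y
  for X :: "'a pair_pre_digraph" and Y :: "'b pair_pre_digraph"
begin

sublocale FS: pair_graph "FS X Y"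
  by (rule pair_graph_FS) (rule X.pair_graph Y.pair_graph)+

abbreviation reach (infix "\<leadsto>" 50) where
  "\<sigma> \<leadsto> \<tau> \<equiv> \<sigma> \<rightarrow>\<^sup>*\<^bsub>with_proj (FS X Y)\<^esub> \<tau>"

lemma pverts_FS [simp]: "pverts (FS X Y) = vertex_bijections X Y"
  by (simp add: FS_def)

lemma comp_permutes_in_vertex_bijections:
  assumes "\<sigma> \<in> vertex_bijections X Y" "p permutes pverts X"
  shows "\<sigma> \<circ> p \<in> vertex_bijections X Y"
proof -
  have "\<sigma> \<circ> p \<in> extensional (pverts X)"
    using assms by (auto simp: vertex_bijections_def extensional_def permutes_def)
  moreover have "bij_betw (\<sigma> \<circ> p) (pverts X) (pverts Y)"
    using assms by (auto simp: vertex_bijections_def intro: bij_betw_trans permutes_imp_bij)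
  ultimately show ?thesis by (simp add: vertex_bijections_def)
qed

lemma swap_in_vertex_bijections:
  assumes "\<sigma> \<in> vertex_bijections X Y" "a \<in> pverts X" "b \<in> pverts X"
  shows "\<sigma> \<circ> Transposition.transpose a b \<in> vertex_bijections X Y"
  using assms by (intro comp_permutes_in_vertex_bijections permutes_swap_id)

lemma FS_arcI:
  assumes "\<sigma> \<in> vertex_bijections X Y" "\<tau> \<in> vertex_bijections X Y"
    and "(a, b) \<in> parcs X" "(\<sigma> a, \<sigma> b) \<in> parcs Y" "\<tau> a = \<sigma> b" "\<tau> b = \<sigma> a"
    and "\<And>w. w \<in> pverts X - {a, b} \<Longrightarrow> \<tau> w = \<sigma> w"
  shows "(\<sigma>, \<tau>) \<in> parcs (FS X Y)"
proof -
  have "a \<in> pverts X" "b \<in> pverts X" "a \<noteq> b"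
    using assms(3) X.wellformed' X.no_loops' by blast+
  then show ?thesis using assms by (simp add: FS_def) blast
qed

lemma reach_swap:
  assumes "\<sigma> \<in> vertex_bijections X Y" "(a, b) \<in> parcs X" "(\<sigma> a, \<sigma> b) \<in> parcs Y"
  shows "\<sigma> \<leadsto> \<sigma> \<circ> Transposition.transpose a b"
proof -
  have "a \<in> pverts X" "b \<in> pverts X" using assms X.wellformed' by blast+
  then have "(\<sigma>, \<sigma> \<circ> Transposition.transpose a b) \<in> parcs (FS X Y)"
    using assms swap_in_vertex_bijections by (intro FS_arcI[of _ _ a b]) auto
  then show ?thesis by (intro FS.reachable_adjI) simp
qed

section \<open>Exchanging two persons by explicit sequences of swaps\<close>

fun slide :: "('a \<Rightarrow> 'b) \<Rightarrow> ('a \<times> 'a) list \<Rightarrow> 'a \<Rightarrow> 'b" where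
  "slide \<sigma> [] = \<sigma>"
| "slide \<sigma> ((a, b) # es) = slide (\<sigma> \<circ> Transposition.transpose a b) es"

fun legal :: "('a \<Rightarrow> 'b) \<Rightarrow> ('a \<times> 'a) list \<Rightarrow> bool" where
  "legal \<sigma> [] \<longleftrightarrow> True"
| "legal \<sigma> ((a, b) # es) \<longleftrightarrow> (a, b) \<in> parcs X \<and> (\<sigma> a, \<sigma> b) \<in> parcs Y \<and>
    legal (\<sigma> \<circ> Transposition.transpose a b) es"

text \<open>For a concrete list of positions \<open>legal\<close> and \<open>slide\<close> can be
  evaluated by rewriting, so an explicit exchange becomes a computation.\<close>

lemma reach_slide:
  assumes "\<sigma> \<in> vertex_bijections X Y" "legal \<sigma> es"
  shows "\<sigma> \<leadsto> slide \<sigma> es"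
  using assms
proof (induction \<sigma> es rule: slide.induct)
  case (2 \<sigma> a b es)
  then have "(a, b) \<in> parcs X" by simp
  with "2.prems" have "\<sigma> \<circ> Transposition.transpose a b \<in> vertex_bijections X Y"
    using swap_in_vertex_bijections X.wellformed' by blast
  with "2.IH" "2.prems" have "\<sigma> \<circ> Transposition.transpose a b \<leadsto> slide \<sigma> ((a, b) # es)"
    by (simp only: slide.simps legal.simps)
  moreover have "\<sigma> \<leadsto> \<sigma> \<circ> Transposition.transpose a b" using 2 by (simp add: reach_swap)
  ultimately show ?case by (rule FS.reachable_trans[rotated])
qed simp

text \<open>The person at \<open>c\<close> walks once around the triangle, so the other two change
  places without ever swapping with each other.\<close>

lemma exchange_triangle:
  assumes "\<sigma> \<in> vertex_bijections X Y"
    and X: "(a, b) \<in> parcs X" "(a, c) \<in> parcs X" "(b, c) \<in> parcs X"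
    and Y: "(\<sigma> a, \<sigma> c) \<in> parcs Y" "(\<sigma> b, \<sigma> c) \<in> parcs Y"
  shows "\<sigma> \<leadsto> \<sigma> \<circ> Transposition.transpose a b"
proof -
  let ?es = "[(a, c), (a, b), (b, c)]"
  have d: "a \<noteq> b" "a \<noteq> c" "b \<noteq> c" using X X.no_loops' by blast+
  have "legal \<sigma> ?es"
    using X Y d Y.arcs_symmetric by (auto simp: Transposition.transpose_def)
  moreover have "slide \<sigma> ?es = \<sigma> \<circ> Transposition.transpose a b"
    using d by (auto simp: fun_eq_iff Transposition.transpose_def)
  ultimately show ?thesis using reach_slide[OF assms(1)] by metis
qed

text \<open>Here \<open>Y\<close> restricted to the four persons is \<open>K\<^sub>4\<close> minus an edge; the move sequence is a shortest
  one.\<close>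

lemma exchange_star:
  assumes "\<sigma> \<in> vertex_bijections X Y"
    and X: "(a, b) \<in> parcs X" "(a, c) \<in> parcs X" "(a, d) \<in> parcs X"
    and d: "b \<noteq> c" "b \<noteq> d" "c \<noteq> d"
    and Y: "(\<sigma> a, \<sigma> c) \<in> parcs Y" "(\<sigma> a, \<sigma> d) \<in> parcs Y" "(\<sigma> b, \<sigma> c) \<in> parcs Y"
      "(\<sigma> b, \<sigma> d) \<in> parcs Y" "(\<sigma> c, \<sigma> d) \<in> parcs Y"
  shows "\<sigma> \<leadsto> \<sigma> \<circ> Transposition.transpose a b"
proof -
  let ?es = "[(a, c), (a, b), (a, d), (a, b), (a, c), (a, b), (a, d)]"
  have d: "a \<noteq> b" "a \<noteq> c" "a \<noteq> d" "b \<noteq> c" "b \<noteq> d" "c \<noteq> d" using X d X.no_loops' by blast+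
  have "legal \<sigma> ?es"
    using X Y Y[THEN Y.arcs_symmetric] d d[symmetric] by simp
  moreover have "slide \<sigma> ?es x = (\<sigma> \<circ> Transposition.transpose a b) x" for x
    using d d[symmetric] by (cases "x \<in> {a, b, c, d}") auto
  then have "slide \<sigma> ?es = \<sigma> \<circ> Transposition.transpose a b" by (rule ext)
  ultimately show ?thesis using reach_slide[OF assms(1)] by metis
qed

text \<open>The person at \<open>d\<close> enters the triangle at \<open>a\<close>, walks around it once and leaves.\<close>

lemma exchange_pendant_triangle:
  assumes "\<sigma> \<in> vertex_bijections X Y"
    and X: "(a, b) \<in> parcs X" "(a, c) \<in> parcs X" "(b, c) \<in> parcs X" "(a, d) \<in> parcs X"
    and d: "d \<noteq> b" "d \<noteq> c"
    and Y: "(\<sigma> d, \<sigma> a) \<in> parcs Y" "(\<sigma> d, \<sigma> b) \<in> parcs Y" "(\<sigma> d, \<sigma> c) \<in> parcs Y"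
  shows "\<sigma> \<leadsto> \<sigma> \<circ> Transposition.transpose b c"
proof -
  let ?es = "[(a, d), (a, b), (b, c), (a, c), (a, d)]"
  have d: "a \<noteq> b" "a \<noteq> c" "a \<noteq> d" "b \<noteq> c" "b \<noteq> d" "c \<noteq> d" using X d X.no_loops' by blast+
  have "legal \<sigma> ?es"
    using X Y Y[THEN Y.arcs_symmetric] d d[symmetric] by simp
  moreover have "slide \<sigma> ?es x = (\<sigma> \<circ> Transposition.transpose b c) x" for x
    using d d[symmetric] by (cases "x \<in> {a, b, c, d}") auto
  then have "slide \<sigma> ?es = \<sigma> \<circ> Transposition.transpose b c" by (rule ext)
  ultimately show ?thesis using reach_slide[OF assms(1)] by metis
qed

text \<open>The transposition of \<open>a\<close> and \<open>b\<close> is that of \<open>a\<close>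
  and \<open>c\<close> conjugated by that of \<open>b\<close> and \<open>c\<close>. The pendant
  triangle with \<open>d\<close> at \<open>a\<close> exchanges \<open>b\<close> and
  \<open>c\<close>, the one with \<open>e\<close> at \<open>b\<close> exchanges \<open>a\<close> and
  \<open>c\<close>. The persons at \<open>d\<close> and \<open>e\<close> end each exchange where
  they began and are friends of all three others, so the hypotheses persist.\<close>

lemma exchange_bull:
  assumes \<sigma>: "\<sigma> \<in> vertex_bijections X Y"
    and X: "(a, b) \<in> parcs X" "(a, c) \<in> parcs X" "(b, c) \<in> parcs X" "(a, d) \<in> parcs X"
      "(b, e) \<in> parcs X"
    and d: "d \<noteq> b" "d \<noteq> c" "e \<noteq> a" "e \<noteq> c"
    and Y: "(\<sigma> d, \<sigma> a) \<in> parcs Y" "(\<sigma> d, \<sigma> b) \<in> parcs Y" "(\<sigma> d, \<sigma> c) \<in> parcs Y"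
      "(\<sigma> e, \<sigma> a) \<in> parcs Y" "(\<sigma> e, \<sigma> b) \<in> parcs Y" "(\<sigma> e, \<sigma> c) \<in> parcs Y"
  shows "\<sigma> \<leadsto> \<sigma> \<circ> Transposition.transpose a b"
proof -
  have d: "a \<noteq> b" "a \<noteq> c" "b \<noteq> c" "a \<noteq> d" "b \<noteq> e" "d \<noteq> b" "d \<noteq> c" "e \<noteq> a" "e \<noteq> c"
    using X d X.no_loops' by blast+
  have V: "a \<in> pverts X" "b \<in> pverts X" "c \<in> pverts X" using X X.wellformed' by blast+
  define \<sigma>1 where "\<sigma>1 = \<sigma> \<circ> Transposition.transpose b c"
  define \<sigma>2 where "\<sigma>2 = \<sigma>1 \<circ> Transposition.transpose a c"
  have in1: "\<sigma>1 \<in> vertex_bijections X Y" unfolding \<sigma>1_def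
    using swap_in_vertex_bijections \<sigma> V by blast
  have in2: "\<sigma>2 \<in> vertex_bijections X Y" unfolding \<sigma>2_def
    using swap_in_vertex_bijections in1 V by blast
  have "\<sigma> \<leadsto> \<sigma>1" unfolding \<sigma>1_def
    by (rule exchange_pendant_triangle[OF \<sigma>, of a _ _ d]) (use X Y d in auto)
  also have "\<sigma>1 \<leadsto> \<sigma>2" unfolding \<sigma>2_def
    by (rule exchange_pendant_triangle[OF in1, of b _ _ e])
      (use X X[THEN X.arcs_symmetric] Y d in \<open>auto simp: \<sigma>1_def Transposition.transpose_def\<close>)
  also have "\<sigma>2 \<leadsto> \<sigma>2 \<circ> Transposition.transpose b c"
    by (rule exchange_pendant_triangle[OF in2, of a _ _ d])
      (use X Y d in \<open>auto simp: \<sigma>1_def \<sigma>2_def Transposition.transpose_def\<close>)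
  also have "\<sigma>2 \<circ> Transposition.transpose b c = \<sigma> \<circ> Transposition.transpose a b"
    using d by (auto simp: \<sigma>1_def \<sigma>2_def fun_eq_iff Transposition.transpose_def)
  finally show ?thesis .
qed

lemma exchange_edge:
  assumes strangers: "\<And>y. y \<in> pverts Y \<Longrightarrow> card {z \<in> pverts Y. z \<noteq> y \<and> (y, z) \<notin> parcs Y} \<le> s"
    and neighbours: "\<And>x. x \<in> pverts X \<Longrightarrow> 2 * s + 2 \<le> card {z. (x, z) \<in> parcs X}"
    and \<sigma>: "\<sigma> \<in> vertex_bijections X Y" and ab: "(a, b) \<in> parcs X"
  shows "\<sigma> \<leadsto> \<sigma> \<circ> Transposition.transpose a b"
proof (cases "(\<sigma> a, \<sigma> b) \<in> parcs Y")
  case True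
  with \<sigma> ab show ?thesis by (rule reach_swap)
next
  case False
  define N where "N x = {z. (x, z) \<in> parcs X}" for x
  \<comment> \<open>Strangers are pulled back along \<open>\<sigma>\<close> to the positions they
    occupy; injectivity carries the bound \<open>s\<close> over.\<close>
  define S where "S x = {z \<in> pverts X. z \<noteq> x \<and> (\<sigma> x, \<sigma> z) \<notin> parcs Y}" for x
  have V: "a \<in> pverts X" "b \<in> pverts X" "a \<noteq> b" and ba: "(b, a) \<in> parcs X"
    using ab X.wellformed' X.no_loops' X.arcs_symmetric by blast+
  have NV: "N x \<subseteq> pverts X" for x using X.wellformed' by (auto simp: N_def)
  then have finN: "finite (N x)" for x using X.pair_finite_verts finite_subset by blast
  have bij: "bij_betw \<sigma> (pverts X) (pverts Y)" using \<sigma> by (simp add: vertex_bijections_def)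
  have finS: "finite (S x)" for x using X.pair_finite_verts by (simp add: S_def)
  have cardS: "card (S x) \<le> s" if "x \<in> pverts X" for x
  proof -
    have "inj_on \<sigma> (S x)"
      using bij by (rule inj_on_subset[OF bij_betw_imp_inj_on]) (auto simp: S_def)
    then have "card (S x) = card (\<sigma> ` S x)" by (simp add: card_image)
    also have "\<dots> \<le> card {z \<in> pverts Y. z \<noteq> \<sigma> x \<and> (\<sigma> x, z) \<notin> parcs Y}"
      using bij that Y.pair_finite_verts
      by (intro card_mono) (auto simp: S_def bij_betw_def inj_on_def)
    also have "\<dots> \<le> s" using bij that by (intro strangers) (auto simp: bij_betw_def)
    finally show ?thesis .
  qed
  have friend: "(\<sigma> x, \<sigma> z) \<in> parcs Y" "(\<sigma> z, \<sigma> x) \<in> parcs Y"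
    if "z \<in> pverts X" "z \<notin> S x" "z \<noteq> x" for x z
    using that Y.arcs_symmetric by (auto simp: S_def)
  have arc: "(x, z) \<in> parcs X" "(z, x) \<in> parcs X" "x \<noteq> z" "z \<in> pverts X" if "z \<in> N x" for x z
    using that X.arcs_symmetric X.no_loops' X.wellformed' by (auto simp: N_def)
  have swap: "\<sigma> \<circ> Transposition.transpose b a = \<sigma> \<circ> Transposition.transpose a b"
    by (simp add: transpose_commute)
  show ?thesis
  proof (rule exchange_configuration[of "N a" "N b" s b a S])
    \<comment> \<open>Leaving out the other end of the edge costs one of the 2s + 2
      neighbours.\<close>
    show "2 * s + 1 \<le> card (N a - {b})" "2 * s + 1 \<le> card (N b - {a})"
      using neighbours[OF V(1)] neighbours[OF V(2)] finN[of a] finN[of b] ab ba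
      by (auto simp: N_def card_Diff_singleton)
    show "a \<notin> N a" "b \<notin> N b" using X.no_loops' by (auto simp: N_def)
    show "b \<in> S a" "a \<in> S b" using V False Y.arcs_symmetric by (auto simp: S_def)
    show "finite (S x) \<and> card (S x) \<le> s" if "x \<in> N a \<union> N b \<union> {a, b}" for x
      using that finS cardS NV V by blast
  next
    fix c assume "c \<in> N a \<inter> N b" "c \<notin> S a \<union> S b"
    then show ?thesis
      using arc[of c a] arc[of c b] friend[of c a] friend[of c b]
      by (intro exchange_triangle[OF \<sigma> ab, of c]) auto
  next
    fix c d assume "c \<in> N a - {b}" "d \<in> N a - {b}" "c \<noteq> d" "c \<notin> S a \<union> S b" "d \<notin> S a \<union> S b"
      "d \<notin> S c"
    then show ?thesis
      using arc[of c a] arc[of d a] friend[of c a] friend[of c b]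
        friend[of d a] friend[of d b] friend[of d c]
      by (intro exchange_star[OF \<sigma> ab, of c d]) auto
  next
    fix c d assume "c \<in> N b - {a}" "d \<in> N b - {a}" "c \<noteq> d" "c \<notin> S a \<union> S b" "d \<notin> S a \<union> S b"
      "d \<notin> S c"
    then have "\<sigma> \<leadsto> \<sigma> \<circ> Transposition.transpose b a"
      using arc[of c b] arc[of d b] friend[of c a] friend[of c b]
        friend[of d a] friend[of d b] friend[of d c]
      by (intro exchange_star[OF \<sigma> ba, of c d]) auto
    then show ?thesis by (simp only: swap)
  next
    fix c d e assume *: "c \<in> N a \<inter> N b" "d \<in> N a - {b}" "e \<in> N b - {a}" "d \<notin> S a \<union> S b"
      "e \<notin> S a \<union> S b" "c \<notin> S d" "c \<notin> S e"
    show ?thesis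
    \<comment> \<open>The \<open>bull\<close> case leaves open whether \<open>c\<close> equals
      \<open>d\<close> or \<open>e\<close>. If \<open>c\<close> is not good, it differs from both,
      which are good; if it is good, the triangle already suffices.\<close>
    proof (cases "c \<in> S a \<union> S b")
      case True
      with * have "d \<noteq> c" "e \<noteq> c" by auto
      with * show ?thesis
        using arc[of c a] arc[of c b] arc[of d a] arc[of e b]
          friend[of d a] friend[of d b] friend[of e a] friend[of e b] friend[of c d] friend[of c e]
        by (intro exchange_bull[OF \<sigma> ab, of c d e]) auto
    next
      case False
      with * show ?thesis
        using arc[of c a] arc[of c b] friend[of c a] friend[of c b]
      by (intro exchange_triangle[OF \<sigma> ab, of c]) auto
    qed
  qed (use finN V in auto)
qed

section \<open>From edges of \<open>X\<close> to arbitrary permutations of the positions\<close>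

lemma reach_swap_if_reachable:
  assumes exchange: "\<And>\<sigma> a b. \<sigma> \<in> vertex_bijections X Y \<Longrightarrow> (a, b) \<in> parcs X \<Longrightarrow>
      \<sigma> \<leadsto> \<sigma> \<circ> Transposition.transpose a b"
    and "a \<rightarrow>\<^sup>*\<^bsub>with_proj X\<^esub> b" and "\<sigma> \<in> vertex_bijections X Y"
  shows "\<sigma> \<leadsto> \<sigma> \<circ> Transposition.transpose a b"
  using assms(2,3)
proof (induction arbitrary: \<sigma> rule: X.reachable_induct)
  case base
  then show ?case by (simp add: FS.reachable_refl)
next
  case (step b c)
  have bc: "(b, c) \<in> parcs X" using step by simp
  have V: "a \<in> pverts X" "b \<in> pverts X" "c \<in> pverts X" "b \<noteq> c"
    using bc step X.reachable_in_verts X.wellformed' X.no_loops' by auto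
  show ?case
  \<comment> \<open>The walk may return to its start, where the transposition is the identity and
    conjugation would give a wrong result.\<close>
  proof (cases "c = a")
    case True
    then show ?thesis using step.prems by (simp add: FS.reachable_refl)
  next
    case False
    \<comment> \<open>The transposition of \<open>a\<close> and \<open>c\<close> is that of
      \<open>b\<close> and \<open>c\<close> conjugated by that of \<open>a\<close> and
      \<open>b\<close>: the outer factors come from the induction hypothesis, the middle one from
      the edge \<open>bc\<close>.\<close>
    let ?\<sigma>1 = "\<sigma> \<circ> Transposition.transpose a b"
    let ?\<sigma>2 = "?\<sigma>1 \<circ> Transposition.transpose b c"
    have in1: "?\<sigma>1 \<in> vertex_bijections X Y"
      using step.prems V(1,2) by (rule swap_in_vertex_bijections)
    have in2: "?\<sigma>2 \<in> vertex_bijections X Y"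
      using in1 V(2,3) by (rule swap_in_vertex_bijections)
    have "\<sigma> \<leadsto> ?\<sigma>1" using step.IH step.prems by blast
    also have "?\<sigma>1 \<leadsto> ?\<sigma>2" using exchange in1 bc by blast
    also have "?\<sigma>2 \<leadsto> ?\<sigma>2 \<circ> Transposition.transpose a b" using step.IH in2 by blast
    also have "?\<sigma>2 \<circ> Transposition.transpose a b = \<sigma> \<circ> Transposition.transpose a c"
      using transpose_comp_triple[of a c b] False V by (simp add: comp_assoc)
    finally show ?thesis .
  qed
qed

lemma ex_permutes_comp:
  assumes "\<sigma> \<in> vertex_bijections X Y" "\<tau> \<in> vertex_bijections X Y"
  obtains p where "p permutes pverts X" "\<tau> = \<sigma> \<circ> p"
proof -
  \<comment> \<open>\<open>p\<close> is \<open>\<tau>\<close> followed by the inverse of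
    \<open>\<sigma>\<close>, continued by the identity as \<open>permutes\<close> requires.\<close>
  define p where "p x = (if x \<in> pverts X then inv_into (pverts X) \<sigma> (\<tau> x) else x)" for x
  have bij: "bij_betw \<sigma> (pverts X) (pverts Y)" "bij_betw \<tau> (pverts X) (pverts Y)"
    and ext: "\<sigma> \<in> extensional (pverts X)" "\<tau> \<in> extensional (pverts X)"
    using assms by (auto simp: vertex_bijections_def)
  have "bij_betw (inv_into (pverts X) \<sigma> \<circ> \<tau>) (pverts X) (pverts X)"
    using bij by (blast intro: bij_betw_trans bij_betw_inv_into)
  then have "bij_betw p (pverts X) (pverts X)"
    by (rule bij_betw_cong[THEN iffD1, rotated]) (simp add: p_def)
  then have "p permutes pverts X" by (rule bij_imp_permutes) (simp add: p_def)
  moreover have "\<tau> x = \<sigma> (p x)" for x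
  proof (cases "x \<in> pverts X")
    case True
    then have "\<tau> x \<in> \<sigma> ` pverts X" using bij by (auto simp: bij_betw_def)
    then show ?thesis using True by (simp add: p_def f_inv_into_f)
  next
    case False
    then show ?thesis using ext by (simp add: p_def extensional_def)
  qed
  ultimately show thesis using that by (auto simp: fun_eq_iff)
qed

text \<open>The case where the degree of \<open>Y\<close> carries the factor 2. With s = n - 1 -
  \<open>min_degree Y\<close> the condition says that \<open>min_degree X\<close> is at least 2s +
  2.\<close>

lemma reach_all_if_degrees:
  assumes conn: "connected (with_proj X)"
    and card: "card (pverts Y) = n"
    and deg: "2 * n \<le> min_degree (with_proj X) + 2 * min_degree (with_proj Y)"
    and \<sigma>: "\<sigma> \<in> vertex_bijections X Y" and \<tau>: "\<tau> \<in> vertex_bijections X Y"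
  shows "\<sigma> \<leadsto> \<tau>"
proof -
  define s where "s = n - 1 - min_degree (with_proj Y)"
  \<comment> \<open>The second conjunct ensures that the natural subtraction in \<open>s\<close>
    does not truncate.\<close>
  have strangers: "card {z \<in> pverts Y. z \<noteq> y \<and> (y, z) \<notin> parcs Y} \<le> s
      \<and> min_degree (with_proj Y) + 1 \<le> n" if y: "y \<in> pverts Y" for y
  proof -
    let ?N = "{z. (y, z) \<in> parcs Y}" and ?S = "{z \<in> pverts Y. z \<noteq> y \<and> (y, z) \<notin> parcs Y}"
    have N: "?N \<subseteq> pverts Y - {y}" using Y.wellformed' Y.no_loops' by blast
    have eq: "?S = pverts Y - {y} - ?N" using Y.no_loops' by auto
    have "card ?S + card ?N = n - 1"
      using card_Diff_subset[OF finite_subset[OF N] N] card_mono[OF _ N] Y.pair_finite_verts card y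
      by (simp add: eq)
    moreover have "0 < n" using card y Y.pair_finite_verts card_gt_0_iff by blast
    ultimately show ?thesis
      using Y.min_degree_le_card_neighbours[OF y] unfolding s_def by linarith
  qed
  have neighbours: "2 * s + 2 \<le> card {z. (x, z) \<in> parcs X}" if x: "x \<in> pverts X" for x
  proof -
    have "\<sigma> x \<in> pverts Y" using \<sigma> x by (auto simp: vertex_bijections_def bij_betw_def)
    then show ?thesis
      using strangers[of "\<sigma> x"] X.min_degree_le_card_neighbours[OF x] deg unfolding s_def
      by linarith
  qed
  have exchange: "\<sigma> \<leadsto> \<sigma> \<circ> Transposition.transpose a b"
    if "\<sigma> \<in> vertex_bijections X Y" "a \<in> pverts X" "b \<in> pverts X" for \<sigma> a b
  proof (rule reach_swap_if_reachable)
    show "\<sigma> \<leadsto> \<sigma> \<circ> Transposition.transpose a b"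
      if "\<sigma> \<in> vertex_bijections X Y" "(a, b) \<in> parcs X" for \<sigma> a b
      using exchange_edge[of s] strangers neighbours that by blast
    show "a \<rightarrow>\<^sup>*\<^bsub>with_proj X\<^esub> b" using conn that X.connected_iff_reachable by blast
  qed fact
  obtain p where p: "p permutes pverts X" "\<tau> = \<sigma> \<circ> p"
    using ex_permutes_comp[OF \<sigma> \<tau>] .
  \<comment> \<open>Induction over a product of transpositions. All \<open>\<sigma>\<close> are
    quantified because the first transposition changes the starting bijection.\<close>
  from p(1) X.pair_finite_verts have "\<forall>\<sigma>\<in>vertex_bijections X Y. \<sigma> \<leadsto> \<sigma> \<circ> p"
  proof (induction rule: permutes_induct)
    case id
    then show ?case by (simp add: FS.reachable_refl)
  next
    case (swap a b p)
    show ?case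
    proof
      fix \<sigma> assume \<sigma>: "\<sigma> \<in> vertex_bijections X Y"
      have "\<sigma> \<leadsto> \<sigma> \<circ> Transposition.transpose a b" using exchange \<sigma> swap by blast
      also have "\<dots> \<leadsto> \<sigma> \<circ> Transposition.transpose a b \<circ> p"
        using swap \<sigma> swap_in_vertex_bijections by blast
      finally show "\<sigma> \<leadsto> \<sigma> \<circ> (Transposition.transpose a b \<circ> p)" by (simp add: comp_assoc)
    qed
  qed
  with \<sigma> p show ?thesis by blast
qed

lemma vertex_bijections_nonempty:
  assumes "card (pverts X) = card (pverts Y)"
  shows "vertex_bijections X Y \<noteq> {}"
proof -
  obtain h where "bij_betw h (pverts X) (pverts Y)"
    using finite_same_card_bij[OF X.pair_finite_verts Y.pair_finite_verts assms] by blast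
  then have "restrict h (pverts X) \<in> vertex_bijections X Y"
    by (simp add: vertex_bijections_def)
  then show ?thesis by blast
qed

section \<open>Exchanging the two graphs\<close>

definition inverse :: "('a \<Rightarrow> 'b) \<Rightarrow> 'b \<Rightarrow> 'a" where
  "inverse \<sigma> = restrict (inv_into (pverts X) \<sigma>) (pverts Y)"

lemma inverse_in_vertex_bijections:
  assumes "\<sigma> \<in> vertex_bijections X Y"
  shows "inverse \<sigma> \<in> vertex_bijections Y X"
  using assms by (simp add: inverse_def vertex_bijections_def bij_betw_inv_into)

lemma inverse_eqI:
  assumes "\<sigma> \<in> vertex_bijections X Y" "x \<in> pverts X" "\<sigma> x = y"
  shows "inverse \<sigma> y = x"
  using assms by (auto simp: inverse_def vertex_bijections_def bij_betw_def inv_into_f_f)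

text \<open>Swapping the persons at two positions is swapping the positions of two persons; the two
  adjacency conditions trade roles.\<close>

lemma inverse_arc:
  assumes "(\<sigma>, \<tau>) \<in> parcs (FS X Y)"
  shows "(inverse \<sigma>, inverse \<tau>) \<in> parcs (FS Y X)"
proof -
  obtain a b where \<sigma>: "\<sigma> \<in> vertex_bijections X Y" and \<tau>: "\<tau> \<in> vertex_bijections X Y"
    and ab: "a \<in> pverts X" "b \<in> pverts X" "a \<noteq> b" "(a, b) \<in> parcs X" "(\<sigma> a, \<sigma> b) \<in> parcs Y"
      "\<tau> a = \<sigma> b" "\<tau> b = \<sigma> a" "\<forall>w \<in> pverts X - {a, b}. \<tau> w = \<sigma> w"
    using assms by (auto simp: FS_def)
  note inv = inverse_eqI[OF \<sigma>] inverse_eqI[OF \<tau>]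
  have rest: "inverse \<tau> y = inverse \<sigma> y" if y: "y \<in> pverts Y - {\<sigma> a, \<sigma> b}" for y
  proof -
    from y \<sigma> obtain x where x: "x \<in> pverts X" "y = \<sigma> x"
      by (auto simp: vertex_bijections_def bij_betw_def)
    with y ab have "\<tau> x = y" by auto
    with x show ?thesis using inv by metis
  qed
  interpret YX: friends_and_strangers Y X ..
  have "inverse \<sigma> (\<sigma> a) = a" "inverse \<sigma> (\<sigma> b) = b" "inverse \<tau> (\<sigma> a) = b" "inverse \<tau> (\<sigma> b) = a"
    using inv ab by auto
  then show ?thesis
    using inverse_in_vertex_bijections \<sigma> \<tau> ab rest
    by (intro YX.FS_arcI[of _ _ "\<sigma> a" "\<sigma> b"]) simp_all
qed

lemma inverse_reachable:
  assumes "\<sigma> \<leadsto> \<tau>"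
  shows "inverse \<sigma> \<rightarrow>\<^sup>*\<^bsub>with_proj (FS Y X)\<^esub> inverse \<tau>"
proof -
  interpret YX: friends_and_strangers Y X ..
  show ?thesis
    using assms
  proof (induction rule: FS.reachable_induct)
    case base
    then show ?case
      using inverse_in_vertex_bijections by simp
  next
    case (step \<tau> \<rho>)
    have "(inverse \<tau>, inverse \<rho>) \<in> parcs (FS Y X)" using step by (simp add: inverse_arc)
    with step.IH show ?case by (rule YX.FS.reachable_adj_trans)
  qed
qed

lemma inverse_inverse:
  assumes "\<sigma> \<in> vertex_bijections X Y"
  shows "friends_and_strangers.inverse Y X (inverse \<sigma>) = \<sigma>"
proof
  interpret YX: friends_and_strangers Y X ..
  fix x
  show "YX.inverse (inverse \<sigma>) x = \<sigma> x"
  proof (cases "x \<in> pverts X")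
    case True
    then show ?thesis
      using assms inverse_in_vertex_bijections inverse_eqI
      by (intro YX.inverse_eqI) (auto simp: vertex_bijections_def bij_betw_def)
  next
    case False
    then show ?thesis using assms by (simp add: YX.inverse_def vertex_bijections_def extensional_def)
  qed
qed

end

theorem theorem1p5:
  fixes X :: "'a pair_pre_digraph" and Y :: "'b pair_pre_digraph" and n :: nat
  assumes "pair_graph X" and "pair_graph Y"
    and "card (pverts X) = n" and "card (pverts Y) = n"
    and "connected X" and "connected Y"
    and "min (min_degree X) (min_degree Y) + 2 * max (min_degree X) (min_degree Y) \<ge> 2 * n"
  shows "connected (FS X Y)"
proof -
  interpret XY: friends_and_strangers X Y using assms by (simp add: friends_and_strangers_def)
  interpret YX: friends_and_strangers Y X using assms by (simp add: friends_and_strangers_def)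
  have "\<sigma> \<rightarrow>\<^sup>*\<^bsub>with_proj (FS X Y)\<^esub> \<tau>"
    if \<sigma>: "\<sigma> \<in> vertex_bijections X Y" and \<tau>: "\<tau> \<in> vertex_bijections X Y" for \<sigma> \<tau>
  proof (cases "min_degree X \<le> min_degree Y")
    case True
    then show ?thesis
      using assms \<sigma> \<tau> by (intro XY.reach_all_if_degrees[of n]) (simp_all add: min_def max_def)
  next
    \<comment> \<open>The inverses are joined by a walk in \<open>FS Y X\<close>, where the denser
      graph \<open>X\<close> is in second place; inverting that walk leads back to
      \<open>\<sigma>\<close> and \<open>\<tau>\<close>.\<close>
    case False
    then have "XY.inverse \<sigma> \<rightarrow>\<^sup>*\<^bsub>with_proj (FS Y X)\<^esub> XY.inverse \<tau>"
      using assms \<sigma> \<tau> XY.inverse_in_vertex_bijections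
      by (intro YX.reach_all_if_degrees[of n]) (simp_all add: min_def max_def)
    from YX.inverse_reachable[OF this] show ?thesis
      using \<sigma> \<tau> by (simp add: XY.inverse_inverse)
  qed
  moreover have "vertex_bijections X Y \<noteq> {}"
    using assms by (intro XY.vertex_bijections_nonempty) simp
  ultimately show ?thesis by (simp add: XY.FS.connected_iff_reachable)
qed

end
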